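(* Let $S$ be a pendent stationary band in $\mathbb{L}^3$, extended to an entire surface. Then $S$ is invariant under a nontrivial group of horizontal translations in the direction orthogonal to the rulings of $S$.
   Context: $\mathbb{L}^3$ is $\mathbb{R}^3$ with the Lorentzian metric $dx_1^2+dx_2^2-dx_3^2$. After a rigid motion preserving the horizontal direction and a vertical translation, an (entire) pendent stationary band is a spacelike surface $S=\{(r,x_2,u(r)): r\in\mathbb{R},\ x_2\in\mathbb{R}\}$, where $u:\mathbb{R}\to\mathbb{R}$ satisfies $|u'|<1$ and $\dfrac{u''(r)}{(1-u'(r)^2)^{3/2}}=\kappa\,u(r)$ for a constant $\kappa<0$ (equivalently, $2H=\kappa x_3$, where $H$ is the mean curvature of $S$ with respect to the unit normal in the time-orientation of $(0,0,1)$). The rulings of $S$ are the lines $\{(r,x_2,u(r)): x_2\in\mathbb{R}\}$ with $r$ fixed; horizontal translations orthogonal to the rulings are the maps $(x_1,x_2,x_3)\mapsto(x_1+c,x_2,x_3)$, $c\in\mathbb{R}$. *)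

theory Defs
  imports "HOL-Analysis.Analysis" "HOL-Algebra.Bij"
begin

definition lorentz :: "real^3 \<Rightarrow> real^3 \<Rightarrow> real" where
  "lorentz x y = x $ 1 * y $ 1 + x $ 2 * y $ 2 - x $ 3 * y $ 3"

definition horizontal :: "real^3 \<Rightarrow> bool" where
  "horizontal v \<longleftrightarrow> v $ 3 = 0"

(* The translation part b is arbitrary, so vertical translations are included. *)
definition horizontal_rigid_motion :: "(real^3 \<Rightarrow> real^3) \<Rightarrow> bool" where
  "horizontal_rigid_motion \<Phi> \<longleftrightarrow>
     (\<exists>A b. linear A \<and>
            (\<forall>x y. lorentz (A x) (A y) = lorentz x y) \<and>
            (\<forall>x. horizontal x \<longrightarrow> horizontal (A x)) \<and>
            \<Phi> = (\<lambda>x. A x + b))"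

definition pendent_profile :: "real \<Rightarrow> (real \<Rightarrow> real) \<Rightarrow> bool" where
  "pendent_profile \<kappa> u \<longleftrightarrow> \<kappa> < 0 \<and>
     (\<exists>u' u''. \<forall>r. (u has_real_derivative u' r) (at r) \<and>
                   (u' has_real_derivative u'' r) (at r) \<and>
                   \<bar>u' r\<bar> < 1 \<and>
                   u'' r / (1 - (u' r)\<^sup>2) powr (3/2) = \<kappa> * u r)"

definition cylinder :: "(real \<Rightarrow> real) \<Rightarrow> (real^3) set" where
  "cylinder u = {vector [r, x2, u r] | r x2. True}"

definition cylinder_rulings :: "(real \<Rightarrow> real) \<Rightarrow> (real^3) set set" where
  "cylinder_rulings u = {{vector [r, x2, u r] | x2. True} | r. True}"

(* The rulings R are part of the data because S alone need not determine them:
   for u = 0 the surface is a horizontal plane. *)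
definition pendent_stationary_band :: "(real^3) set \<Rightarrow> (real^3) set set \<Rightarrow> bool" where
  "pendent_stationary_band S R \<longleftrightarrow>
     (\<exists>\<Phi> \<kappa> u. horizontal_rigid_motion \<Phi> \<and> pendent_profile \<kappa> u \<and>
              S = \<Phi> ` cylinder u \<and> R = (\<lambda>l. \<Phi> ` l) ` cylinder_rulings u)"

definition orthogonal_to_rulings :: "real^3 \<Rightarrow> (real^3) set set \<Rightarrow> bool" where
  "orthogonal_to_rulings v R \<longleftrightarrow> (\<forall>l\<in>R. \<forall>p\<in>l. \<forall>q\<in>l. lorentz v (p - q) = 0)"

definition orthogonal_horizontal_translations ::
    "(real^3) set set \<Rightarrow> (real^3 \<Rightarrow> real^3) set" where
  "orthogonal_horizontal_translations R =
     {(\<lambda>x. x + v) | v. horizontal v \<and> orthogonal_to_rulings v R}"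

end

theory Submission
  imports Defs
begin

text \<open>
  After a horizontal rigid motion the band is a cylinder over a pendent profile \<open>u\<close>, and the
  claim reduces to the periodicity of \<open>u\<close>: a period \<open>c\<close> makes the cylinder invariant under the
  translation by \<open>c\<close> along the first axis, and conjugating by the rigid motion \<open>x \<mapsto> A x + b\<close> turns
  this into the translation by \<open>c *\<^sub>R A (axis 1 1)\<close>. This vector is horizontal and
  Lorentz-orthogonal to the rulings because \<open>A\<close> preserves both properties. The translations by all
  periods form the required group.

  The momentum \<open>p = u' / sqrt (1 - u'\<^sup>2)\<close> turns the profile equation into the Hamiltonian system
  \<open>u' = velocity p\<close>, \<open>p' = \<kappa> u\<close>, which has the form \<open>x' = f y\<close>, \<open>y' = - h x\<close> with \<open>f\<close> and \<open>h\<close>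
  odd, increasing and Lipschitz. Every solution of such a system is periodic, as
  \<open>solution_periodic\<close> shows for \<open>x\<close>. By uniqueness, \<open>x\<close> is odd about each of its zeros and even
  about each zero of \<open>y\<close>. If \<open>x a = 0\<close> and \<open>y b = 0\<close>, then composing the two reflections shows that
  translation by \<open>2 * (b - a)\<close> changes the sign of \<open>x\<close>, so \<open>4 * (b - a)\<close> is a period. If \<open>a = b\<close>,
  uniqueness forces \<open>x = 0\<close>, which has every period. Zeros exist by concavity: where \<open>x\<close> is
  positive, \<open>y\<close> and hence \<open>x' = f y\<close> decrease, and a positive function on the whole line cannot be
  concave unless it is constant.
\<close>

section \<open>Periodicity of odd planar Hamiltonian systems\<close>

text \<open>The bound on \<open>d'\<close> says that \<open>d r * exp (- M * r)\<close> does not increase.\<close>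

lemma gronwall_zero_right:
  fixes d d' :: "real \<Rightarrow> real"
  assumes deriv: "\<And>r. (d has_real_derivative d' r) (at r)"
    and bound: "\<And>r. d' r \<le> M * d r"
    and nonneg: "\<And>r. 0 \<le> d r" and zero: "d a = 0" and "a \<le> r"
  shows "d r = 0"
proof -
  have "d r * exp (- M * r) \<le> d a * exp (- M * a)"
  proof (rule DERIV_nonpos_imp_nonincreasing[OF \<open>a \<le> r\<close>])
    fix s
    have "((\<lambda>s. d s * exp (- M * s)) has_real_derivative (d' s - M * d s) * exp (- M * s)) (at s)"
      by (auto intro!: derivative_eq_intros deriv simp: algebra_simps)
    moreover have "(d' s - M * d s) * exp (- M * s) \<le> 0"
      using bound[of s] by (simp add: mult_nonpos_nonneg)
    ultimately show "\<exists>z. ((\<lambda>s. d s * exp (- M * s)) has_real_derivative z) (at s) \<and> z \<le> 0"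
      by blast
  qed
  then have "d r \<le> 0"
    by (simp add: zero mult_le_0_iff)
  with nonneg[of r] show ?thesis by simp
qed

lemma gronwall_zero:
  fixes d d' :: "real \<Rightarrow> real"
  assumes deriv: "\<And>r. (d has_real_derivative d' r) (at r)"
    and bound: "\<And>r. \<bar>d' r\<bar> \<le> M * d r"
    and nonneg: "\<And>r. 0 \<le> d r" and zero: "d a = 0"
  shows "d r = 0"
proof (cases "a \<le> r")
  case True
  have "\<And>r. d' r \<le> M * d r" using bound abs_le_D1 by blast
  from gronwall_zero_right[OF deriv this nonneg zero True] show ?thesis .
next
  case False
  have "((\<lambda>s. d (- s)) has_real_derivative - d' (- s)) (at s)" for s
    using DERIV_mirror[of d "d' (- s)" s] deriv[of "- s"] by simp
  moreover have "- d' (- s) \<le> M * d (- s)" for s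
    using bound abs_le_D2 by blast
  ultimately have "d (- (- r)) = 0"
    by (rule gronwall_zero_right[where a = "- a"]) (use nonneg zero False in auto)
  then show ?thesis by simp
qed

lemma deriv_reflect:
  fixes x :: "real \<Rightarrow> real"
  assumes "(x has_real_derivative D) (at (c - r))"
  shows "((\<lambda>r. x (c - r)) has_real_derivative - D) (at r)"
proof -
  have "((\<lambda>r. c - r) has_real_derivative - 1) (at r)"
    by (auto intro!: derivative_eq_intros)
  from DERIV_chain2[where f = x and g = "\<lambda>r. c - r", OF assms this] show ?thesis by simp
qed

text \<open>A tangent line of nonzero slope lies above the graph and has a zero.\<close>

lemma concave_positive_imp_deriv_zero:
  fixes x x' :: "real \<Rightarrow> real"
  assumes deriv: "\<And>r. (x has_real_derivative x' r) (at r)"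
    and anti: "antimono x'" and pos: "\<And>r. 0 < x r"
  shows "x' r = 0"
proof (rule ccontr)
  assume nz: "x' r \<noteq> 0"
  have tangent: "x s \<le> x r + x' r * (s - r)" for s
  proof (cases s r rule: linorder_cases)
    case less
    then obtain z where z: "s < z" "z < r" "x r - x s = (r - s) * x' z"
      using MVT2[of s r x x'] deriv by blast
    have "(r - s) * x' r \<le> (r - s) * x' z"
      using antimonoD[OF anti, of z r] z less by (intro mult_left_mono) auto
    with z show ?thesis by (simp add: algebra_simps)
  next
    case greater
    then obtain z where z: "r < z" "z < s" "x s - x r = (s - r) * x' z"
      using MVT2[of r s x x'] deriv by blast
    have "(s - r) * x' z \<le> (s - r) * x' r"
      using antimonoD[OF anti, of r z] z greater by (intro mult_left_mono) auto
    with z show ?thesis by (simp add: algebra_simps)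
  qed simp
  have "x (r - x r / x' r) \<le> 0"
    using tangent[of "r - x r / x' r"] nz by simp
  with pos[of "r - x r / x' r"] show False by simp
qed

text \<open>
  The hypotheses are symmetric in \<open>f\<close> and \<open>h\<close>. Since \<open>(x, y) \<mapsto> (y, - x)\<close> turns solutions for
  \<open>(f, h)\<close> into solutions for \<open>(h, f)\<close>, every fact about the zeros of \<open>x\<close> yields one about \<open>y\<close>.
\<close>

locale odd_planar_system =
  fixes f h :: "real \<Rightarrow> real" and L :: real
  assumes f_odd: "f (- t) = - f t" and h_odd: "h (- t) = - h t"
    and f_mono: "strict_mono f" and h_mono: "strict_mono h"
    and f_lip: "\<bar>f s - f t\<bar> \<le> L * \<bar>s - t\<bar>"
    and h_lip: "\<bar>h s - h t\<bar> \<le> L * \<bar>s - t\<bar>"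
begin

definition solution :: "(real \<Rightarrow> real) \<Rightarrow> (real \<Rightarrow> real) \<Rightarrow> bool" where
  "solution x y \<longleftrightarrow> (\<forall>r. (x has_real_derivative f (y r)) (at r) \<and>
                        (y has_real_derivative - h (x r)) (at r))"

lemma solution_deriv_fst: "solution x y \<Longrightarrow> (x has_real_derivative f (y r)) (at r)"
  and solution_deriv_snd: "solution x y \<Longrightarrow> (y has_real_derivative - h (x r)) (at r)"
  by (simp_all add: solution_def)

lemma f_0: "f 0 = 0" and h_0: "h 0 = 0"
  using f_odd[of 0] h_odd[of 0] by simp_all

lemma h_pos: "0 < t \<Longrightarrow> 0 < h t"
  using strict_monoD[OF h_mono, of 0 t] h_0 by simp

text \<open>
  The squared distance \<open>d\<close> of two solutions satisfies \<open>\<bar>d'\<bar> \<le> 2 * L * d\<close> by the Lipschitz bounds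
  and the inequality \<open>2 * s * t \<le> s\<^sup>2 + t\<^sup>2\<close>.
\<close>

lemma solution_unique:
  assumes sol: "solution x y" "solution v w" and init: "x a = v a" "y a = w a"
  shows "x r = v r \<and> y r = w r"
proof -
  define d where "d r = (x r - v r)\<^sup>2 + (y r - w r)\<^sup>2" for r
  define d' where "d' r = 2 * (x r - v r) * (f (y r) - f (w r))
    - 2 * (y r - w r) * (h (x r) - h (v r))" for r
  have "0 \<le> L" using f_lip[of 1 0] by simp
  have "(d has_real_derivative d' r) (at r)" for r
    using sol unfolding solution_def d_def d'_def
    by (auto intro!: derivative_eq_intros) (simp add: algebra_simps)
  moreover have "\<bar>d' r\<bar> \<le> (2 * L) * d r" for r
  proof -
    have "\<bar>d' r\<bar> \<le> 2 * (\<bar>x r - v r\<bar> * \<bar>f (y r) - f (w r)\<bar>)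
        + 2 * (\<bar>y r - w r\<bar> * \<bar>h (x r) - h (v r)\<bar>)"
      using abs_triangle_ineq4[of "2 * (x r - v r) * (f (y r) - f (w r))"
          "2 * (y r - w r) * (h (x r) - h (v r))"]
      unfolding d'_def abs_mult by (simp only: abs_numeral mult.assoc)
    also have "\<dots> \<le> 2 * (\<bar>x r - v r\<bar> * (L * \<bar>y r - w r\<bar>))
        + 2 * (\<bar>y r - w r\<bar> * (L * \<bar>x r - v r\<bar>))"
      by (intro add_mono mult_left_mono f_lip h_lip) auto
    also have "\<dots> = (2 * L) * (2 * \<bar>x r - v r\<bar> * \<bar>y r - w r\<bar>)" by (simp add: algebra_simps)
    also have "\<dots> \<le> (2 * L) * d r"
      using sum_squares_bound[of "\<bar>x r - v r\<bar>" "\<bar>y r - w r\<bar>"] \<open>0 \<le> L\<close>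
      unfolding d_def by (intro mult_left_mono) auto
    finally show ?thesis .
  qed
  ultimately have "d r = 0"
    by (rule gronwall_zero[where a = a]) (simp_all add: d_def init)
  then show ?thesis by (simp add: d_def sum_power2_eq_zero_iff)
qed

text \<open>
  Since \<open>h\<close> is odd, \<open>(- x, y)\<close> with time reflected at a zero \<open>a\<close> of \<open>x\<close> is again a solution,
  and it agrees with \<open>(x, y)\<close> at \<open>a\<close>. Since \<open>f\<close> is odd, the same holds for \<open>(x, - y)\<close> at a zero of \<open>y\<close>.
\<close>

lemma reflect_at_zero_fst:
  assumes "solution x y" "x a = 0"
  shows "x (2 * a - r) = - x r"
proof -
  have "solution (\<lambda>r. - x (2 * a - r)) (\<lambda>r. y (2 * a - r))"
    unfolding solution_def
  proof (intro allI conjI)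
    fix r
    show "((\<lambda>r. - x (2 * a - r)) has_real_derivative f (y (2 * a - r))) (at r)"
      using DERIV_minus[OF deriv_reflect[OF solution_deriv_fst[OF assms(1)]]] by simp
    show "((\<lambda>r. y (2 * a - r)) has_real_derivative - h (- x (2 * a - r))) (at r)"
      using deriv_reflect[OF solution_deriv_snd[OF assms(1)]] by (simp add: h_odd)
  qed
  from solution_unique[OF assms(1) this, of a r] show ?thesis by (simp add: assms(2))
qed

lemma reflect_at_zero_snd:
  assumes "solution x y" "y b = 0"
  shows "x (2 * b - r) = x r"
proof -
  have "solution (\<lambda>r. x (2 * b - r)) (\<lambda>r. - y (2 * b - r))"
    unfolding solution_def
  proof (intro allI conjI)
    fix r
    show "((\<lambda>r. x (2 * b - r)) has_real_derivative f (- y (2 * b - r))) (at r)"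
      using deriv_reflect[OF solution_deriv_fst[OF assms(1)]] by (simp add: f_odd)
    show "((\<lambda>r. - y (2 * b - r)) has_real_derivative - h (x (2 * b - r))) (at r)"
      using DERIV_minus[OF deriv_reflect[OF solution_deriv_snd[OF assms(1)]]] by simp
  qed
  from solution_unique[OF assms(1) this, of b r] show ?thesis by (simp add: assms(2))
qed

text \<open>
  A positive \<open>x\<close> would be concave, hence constant. Then \<open>f y = 0\<close>, so \<open>y\<close> vanishes identically, and
  \<open>h x = - y' = 0\<close> contradicts \<open>0 < h x\<close>.
\<close>

lemma solution_not_positive:
  assumes sol: "solution x y" and pos: "\<And>r. 0 < x r"
  shows False
proof -
  note dx = solution_deriv_fst[OF sol] and dy = solution_deriv_snd[OF sol]
  have "antimono y"
  proof (rule antimonoI)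
    fix r s :: real assume "r \<le> s"
    show "y s \<le> y r"
      by (rule DERIV_nonpos_imp_nonincreasing[OF \<open>r \<le> s\<close>])
        (use dy h_pos[OF pos] in \<open>meson neg_le_0_iff_le order_less_imp_le\<close>)
  qed
  then have "antimono (\<lambda>r. f (y r))"
    using strict_mono_mono[OF f_mono] by (auto simp: antimono_def mono_def)
  from concave_positive_imp_deriv_zero[OF dx this pos] have "f (y r) = 0" for r .
  then have "y r = 0" for r
    using strict_mono_eq[OF f_mono, of "y r" 0] f_0 by simp
  then have "y = (\<lambda>r. 0)" by auto
  then have "(y has_real_derivative 0) (at 0)" by simp
  with dy[of 0] have "- h (x 0) = 0" by (rule DERIV_unique)
  with h_pos[OF pos[of 0]] show False by simp
qed

lemma solution_uminus: "solution x y \<Longrightarrow> solution (\<lambda>r. - x r) (\<lambda>r. - y r)"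
  unfolding solution_def f_odd h_odd by (blast intro: DERIV_minus)

lemma solution_has_zero:
  assumes sol: "solution x y"
  shows "\<exists>a. x a = 0"
proof (rule ccontr)
  assume nz: "\<nexists>a. x a = 0"
  have cont: "continuous_on UNIV x"
    using sol by (auto simp: solution_def intro!: DERIV_continuous_on[where D = "\<lambda>r. f (y r)"])
  have conn: "connected (range x)" using connected_continuous_image[OF cont connected_UNIV] .
  have sign: False if "x p < 0" "0 < x q" for p q
    using connectedD_interval[OF conn, of "x p" "x q" 0] that nz by fastforce
  show False
  proof (cases "0 < x 0")
    case True
    with sign nz have "0 < x r" for r by (metis linorder_neqE)
    with solution_not_positive[OF sol] show False .
  next
    case False
    with sign nz have "0 < - x r" for r by (metis linorder_neqE neg_0_less_iff_less)
    with solution_not_positive[OF solution_uminus[OF sol]] show False .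
  qed
qed

end

lemma (in odd_planar_system) solution_periodic:
  assumes sol: "solution x y"
  shows "\<exists>T. T \<noteq> 0 \<and> (\<forall>r. x (r + T) = x r)"
proof -
  interpret dual: odd_planar_system h f L
    by unfold_locales (use f_odd h_odd f_mono h_mono f_lip h_lip in auto)
  obtain a where a: "x a = 0" using solution_has_zero[OF sol] ..
  have "dual.solution y (\<lambda>r. - x r)"
    unfolding dual.solution_def h_odd
    using solution_deriv_snd[OF sol] DERIV_minus[OF solution_deriv_fst[OF sol]] by simp
  then obtain b where b: "y b = 0" using dual.solution_has_zero by blast
  show ?thesis
  proof (cases "a = b")
    case True
    have "solution (\<lambda>r. 0) (\<lambda>r. 0)" by (simp add: solution_def f_0 h_0)
    then have "x r = 0" for r
      using solution_unique[OF sol, of "\<lambda>r. 0" "\<lambda>r. 0" a r] a b True by simp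
    then show ?thesis by (intro exI[of _ 1]) simp
  next
    case False
    have half: "x (r + 2 * (b - a)) = - x r" for r
    proof -
      have "x (r + 2 * (b - a)) = x (2 * b - (2 * a - r))" by (simp add: algebra_simps)
      also have "\<dots> = - x r"
        by (simp only: reflect_at_zero_snd[OF sol b] reflect_at_zero_fst[OF sol a])
      finally show ?thesis .
    qed
    have "x (r + 4 * (b - a)) = x r" for r
      using half[of r] half[of "r + 2 * (b - a)"] by (simp add: algebra_simps)
    with False show ?thesis by (intro exI[of _ "4 * (b - a)"]) simp
  qed
qed

section \<open>Periodicity of pendent profiles\<close>

text \<open>
  The inverse of the relativistic momentum \<open>v \<mapsto> v / sqrt (1 - v\<^sup>2)\<close>, which maps the interval
  \<open>{- 1<..<1}\<close> of slopes of spacelike curves onto the whole line. In this variable the singular factor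
  \<open>(1 - u'\<^sup>2) powr (3/2)\<close> disappears and the equation becomes globally Lipschitz.
\<close>

definition velocity :: "real \<Rightarrow> real" where
  "velocity p = p / sqrt (1 + p\<^sup>2)"

lemma velocity_deriv:
  "(velocity has_real_derivative 1 / sqrt (1 + p\<^sup>2) ^ 3) (at p)"
proof -
  have pos: "0 < 1 + p\<^sup>2" by (simp add: add_pos_nonneg)
  define s where "s = sqrt (1 + p\<^sup>2)"
  have s: "0 < s" "s\<^sup>2 = 1 + p\<^sup>2" using pos by (simp_all add: s_def)
  have "((\<lambda>p. p / sqrt (1 + p\<^sup>2)) has_real_derivative (s - p * (p / s)) / (s * s)) (at p)"
    using pos s by (auto intro!: derivative_eq_intros simp: s_def[symmetric] field_simps)
  moreover have "(s - p * (p / s)) / (s * s) = 1 / s ^ 3"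
    using s by (simp add: field_simps power3_eq_cube power2_eq_square)
  ultimately show ?thesis by (simp add: velocity_def[abs_def] s_def)
qed

lemma velocity_strict_mono: "strict_mono velocity"
proof (rule strict_monoI)
  fix p q :: real assume "p < q"
  then show "velocity p < velocity q"
    by (rule DERIV_pos_imp_increasing)
      (meson velocity_deriv add_pos_nonneg real_sqrt_gt_zero zero_less_divide_1_iff
        zero_less_one zero_le_power2 zero_less_power)
qed

lemma velocity_lipschitz: "\<bar>velocity p - velocity q\<bar> \<le> \<bar>p - q\<bar>"
proof -
  have "norm (velocity p - velocity q) \<le> 1 * norm (p - q)"
  proof (rule field_differentiable_bound[OF convex_UNIV])
    show "(velocity has_field_derivative 1 / sqrt (1 + t\<^sup>2) ^ 3) (at t within UNIV)" for t
      by (rule velocity_deriv)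
    show "norm (1 / sqrt (1 + t\<^sup>2) ^ 3) \<le> 1" for t :: real
    proof -
      have "1 \<le> sqrt (1 + t\<^sup>2) ^ 3" by (rule one_le_power) simp
      then show ?thesis by (simp add: divide_le_eq_1 add_pos_nonneg)
    qed
  qed simp_all
  then show ?thesis by simp
qed

lemma velocity_momentum:
  assumes "\<bar>v\<bar> < 1"
  shows "velocity (v / sqrt (1 - v\<^sup>2)) = v"
proof -
  have pos: "0 < 1 - v\<^sup>2" using assms by (simp add: abs_square_less_1)
  then have "1 + (v / sqrt (1 - v\<^sup>2))\<^sup>2 = 1 / (1 - v\<^sup>2)"
    by (simp add: power_divide field_simps)
  with pos show ?thesis by (simp add: velocity_def real_sqrt_divide)
qed

lemma momentum_deriv:
  assumes "\<bar>v r\<bar> < 1" and "(v has_real_derivative D) (at r)"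
  shows "((\<lambda>r. v r / sqrt (1 - (v r)\<^sup>2)) has_real_derivative D / (1 - (v r)\<^sup>2) powr (3/2)) (at r)"
proof -
  have pos: "0 < 1 - (v r)\<^sup>2" using assms(1) by (simp add: abs_square_less_1)
  define s where "s = sqrt (1 - (v r)\<^sup>2)"
  have s: "0 < s" "s\<^sup>2 = 1 - (v r)\<^sup>2" using pos by (simp_all add: s_def)
  have "(1 - (v r)\<^sup>2) powr (3/2) = s ^ 3"
    using pos powr_powr[of "1 - (v r)\<^sup>2" "1/2" 3] s by (simp add: s_def powr_half_sqrt)
  moreover have "((\<lambda>r. v r / sqrt (1 - (v r)\<^sup>2)) has_real_derivative
      (D * s + v r * (v r * D / s)) / (s * s)) (at r)"
    using pos s assms(2)
    by (auto intro!: derivative_eq_intros simp: s_def[symmetric] field_simps)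
  moreover have "(D * s + v r * (v r * D / s)) / (s * s) = D / s ^ 3"
  proof -
    have "D * s + v r * (v r * D / s) = D * (s\<^sup>2 + (v r)\<^sup>2) / s"
      using s(1) by (simp add: field_simps power2_eq_square)
    then show ?thesis using s by (simp add: power3_eq_cube)
  qed
  ultimately show ?thesis by simp
qed

lemma pendent_profile_periodic:
  assumes "pendent_profile \<kappa> u"
  shows "\<exists>T. T \<noteq> 0 \<and> (\<forall>r. u (r + T) = u r)"
proof -
  from assms obtain u' u'' where \<kappa>: "\<kappa> < 0"
    and u: "\<And>r. (u has_real_derivative u' r) (at r)"
      "\<And>r. (u' has_real_derivative u'' r) (at r)"
      "\<And>r. \<bar>u' r\<bar> < 1" "\<And>r. u'' r / (1 - (u' r)\<^sup>2) powr (3/2) = \<kappa> * u r"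
    unfolding pendent_profile_def by blast
  interpret odd_planar_system velocity "\<lambda>t. - \<kappa> * t" "max 1 (- \<kappa>)"
  proof
    show "\<bar>velocity s - velocity t\<bar> \<le> max 1 (- \<kappa>) * \<bar>s - t\<bar>" for s t
      using mult_right_mono[of 1 "max 1 (- \<kappa>)" "\<bar>s - t\<bar>"] velocity_lipschitz[of s t] by simp
    show "\<bar>- \<kappa> * s - - \<kappa> * t\<bar> \<le> max 1 (- \<kappa>) * \<bar>s - t\<bar>" for s t
    proof -
      have "\<bar>- \<kappa> * s - - \<kappa> * t\<bar> = - \<kappa> * \<bar>s - t\<bar>"
        using \<kappa> abs_mult[of "- \<kappa>" "s - t"] by (simp add: algebra_simps)
      also have "\<dots> \<le> max 1 (- \<kappa>) * \<bar>s - t\<bar>" by (intro mult_right_mono) auto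
      finally show ?thesis .
    qed
    show "strict_mono (\<lambda>t. - \<kappa> * t)" using \<kappa> by (simp add: strict_mono_def)
  qed (simp_all add: velocity_strict_mono velocity_def)
  have "solution u (\<lambda>r. u' r / sqrt (1 - (u' r)\<^sup>2))"
    unfolding solution_def velocity_momentum[OF u(3)]
    using u(1) momentum_deriv[OF u(3) u(2)] by (simp add: u(4))
  then show ?thesis by (rule solution_periodic)
qed

section \<open>Translations of the cylinder\<close>

lemma translations_subgroup:
  fixes W :: "'a::ab_group_add set"
  assumes "0 \<in> W" "\<And>v w. v \<in> W \<Longrightarrow> w \<in> W \<Longrightarrow> v + w \<in> W" "\<And>v. v \<in> W \<Longrightarrow> - v \<in> W"
  shows "subgroup ((\<lambda>v x. x + v) ` W) (BijGroup UNIV)"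
proof -
  have bij: "(\<lambda>x. x + v) \<in> Bij (UNIV :: 'a set)" for v
    by (simp add: Bij_def extensional_def bij_plus_right)
  have mult: "(\<lambda>x. x + v) \<otimes>\<^bsub>BijGroup UNIV\<^esub> (\<lambda>x. x + w) = (\<lambda>x. x + (v + w))" for v w :: 'a
  proof -
    have "(\<lambda>x. x + v) \<otimes>\<^bsub>BijGroup UNIV\<^esub> (\<lambda>x. x + w) = (\<lambda>x. x + w + v)"
      by (simp add: BijGroup_def compose_def restrict_def bij)
    also have "\<dots> = (\<lambda>x. x + (v + w))" by (simp add: ac_simps)
    finally show ?thesis .
  qed
  have one: "\<one>\<^bsub>BijGroup UNIV\<^esub> = (\<lambda>x. x + (0 :: 'a))"
    by (simp add: BijGroup_def restrict_def)
  have inv: "inv\<^bsub>BijGroup UNIV\<^esub> (\<lambda>x. x + v) = (\<lambda>x. x + - v)" for v :: 'a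
  proof (rule group.inv_equality[OF group_BijGroup])
    show "(\<lambda>x. x + - v) \<otimes>\<^bsub>BijGroup UNIV\<^esub> (\<lambda>x. x + v) = \<one>\<^bsub>BijGroup UNIV\<^esub>"
      unfolding mult one by simp
    show "(\<lambda>x. x + v) \<in> carrier (BijGroup UNIV)" "(\<lambda>x. x + - v) \<in> carrier (BijGroup UNIV)"
      unfolding BijGroup_def by (simp_all only: partial_object.select_convs bij)
  qed
  show ?thesis
  proof (rule group.subgroupI[OF group_BijGroup])
    show "(\<lambda>v x. x + v) ` W \<subseteq> carrier (BijGroup UNIV)"
      using bij by (auto simp: BijGroup_def)
    show "inv\<^bsub>BijGroup UNIV\<^esub> g \<in> (\<lambda>v x. x + v) ` W" if "g \<in> (\<lambda>v x. x + v) ` W" for g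
    proof -
      from that obtain v where "v \<in> W" and g: "g = (\<lambda>x. x + v)" by blast
      then show ?thesis unfolding g inv by (blast intro: assms(3))
    qed
    show "g \<otimes>\<^bsub>BijGroup UNIV\<^esub> k \<in> (\<lambda>v x. x + v) ` W"
      if "g \<in> (\<lambda>v x. x + v) ` W" "k \<in> (\<lambda>v x. x + v) ` W" for g k
    proof -
      from that obtain v w where "v \<in> W" "w \<in> W" and g: "g = (\<lambda>x. x + v)" and k: "k = (\<lambda>x. x + w)"
        by blast
      then show ?thesis unfolding g k mult by (blast intro: assms(2))
    qed
  qed (use assms(1) in blast)
qed

lemma cylinder_translate:
  assumes "\<And>r. u (r + c) = u r"
  shows "(\<lambda>p. p + c *\<^sub>R axis 1 1) ` cylinder u = cylinder u"
proof -
  have shift: "vector [r, x2, u r] + c *\<^sub>R axis 1 1 = (vector [r + c, x2, u (r + c)] :: real^3)"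
    for r x2
    by (simp add: assms vec_eq_iff forall_3 axis_def)
  have "cylinder u \<subseteq> (\<lambda>p. p + c *\<^sub>R axis 1 1) ` cylinder u"
  proof
    fix p assume "p \<in> cylinder u"
    then obtain r x2 where "p = vector [r, x2, u r]" by (auto simp: cylinder_def)
    then have "p = vector [r - c, x2, u (r - c)] + c *\<^sub>R axis 1 1" by (simp add: shift)
    then show "p \<in> (\<lambda>p. p + c *\<^sub>R axis 1 1) ` cylinder u" by (auto simp: cylinder_def)
  qed
  moreover have "(\<lambda>p. p + c *\<^sub>R axis 1 1) ` cylinder u \<subseteq> cylinder u"
  proof (rule image_subsetI)
    fix p assume "p \<in> cylinder u"
    then obtain r x2 where "p = vector [r, x2, u r]" by (auto simp: cylinder_def)
    then have "p + c *\<^sub>R axis 1 1 = vector [r + c, x2, u (r + c)]" by (simp only: shift)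
    then show "p + c *\<^sub>R axis 1 1 \<in> cylinder u" unfolding cylinder_def by blast
  qed
  ultimately show ?thesis by blast
qed

lemma lorentz_axis_1_orthogonal_ruling:
  "l \<in> cylinder_rulings u \<Longrightarrow> p \<in> l \<Longrightarrow> q \<in> l \<Longrightarrow> lorentz (axis 1 1) (p - q) = 0"
  by (auto simp: cylinder_rulings_def lorentz_def axis_def)

theorem corollary6p2:
  fixes S :: "(real^3) set" and R :: "(real^3) set set"
  assumes "pendent_stationary_band S R"
  shows "\<exists>G. subgroup G (BijGroup (UNIV :: (real^3) set)) \<and>
             G \<subseteq> orthogonal_horizontal_translations R \<and>
             G \<noteq> {id} \<and>
             (\<forall>g\<in>G. g ` S = S)"
proof -
  from assms obtain \<Phi> \<kappa> u where "horizontal_rigid_motion \<Phi>" and u: "pendent_profile \<kappa> u"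
    and S: "S = \<Phi> ` cylinder u" and R: "R = (\<lambda>l. \<Phi> ` l) ` cylinder_rulings u"
    unfolding pendent_stationary_band_def by blast
  then obtain A b where A: "linear A" "\<And>x y. lorentz (A x) (A y) = lorentz x y"
    "\<And>x. horizontal x \<Longrightarrow> horizontal (A x)" and \<Phi>: "\<Phi> = (\<lambda>x. A x + b)"
    unfolding horizontal_rigid_motion_def by blast
  interpret A: linear A by (fact A(1))
  define e where "e = A (axis 1 1)"
  (* All periods are used, rather than the multiples of one: they visibly form a group. *)
  define P where "P = {c. \<forall>r. u (r + c) = u r}"
  define G where "G = (\<lambda>v x. x + v) ` (\<lambda>c. c *\<^sub>R e) ` P"
  have P_minus: "- c \<in> P" if "c \<in> P" for c
    unfolding P_def
  proof (rule CollectI, rule allI)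
    fix r
    have "u (r + - c + c) = u (r + - c)" using that unfolding P_def by blast
    then show "u (r + - c) = u r" by simp
  qed
  have P_add: "c + d \<in> P" if "c \<in> P" "d \<in> P" for c d
    using that unfolding P_def by (simp add: add.assoc[symmetric])
  have "subgroup G (BijGroup UNIV)"
    unfolding G_def
  proof (rule translations_subgroup)
    have "0 \<in> P" by (simp add: P_def)
    then show "0 \<in> (\<lambda>c. c *\<^sub>R e) ` P" by force
    show "v + w \<in> (\<lambda>c. c *\<^sub>R e) ` P" if "v \<in> (\<lambda>c. c *\<^sub>R e) ` P" "w \<in> (\<lambda>c. c *\<^sub>R e) ` P" for v w
      using that P_add by (force simp: scaleR_add_left[symmetric])
    show "- v \<in> (\<lambda>c. c *\<^sub>R e) ` P" if "v \<in> (\<lambda>c. c *\<^sub>R e) ` P" for v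
      using that P_minus by force
  qed
  moreover have "G \<subseteq> orthogonal_horizontal_translations R"
  proof
    fix g assume "g \<in> G"
    then obtain c where g: "g = (\<lambda>x. x + c *\<^sub>R e)" by (auto simp: G_def)
    have "horizontal e" unfolding e_def by (rule A(3)) (simp add: horizontal_def axis_def)
    then have "horizontal (c *\<^sub>R e)" by (simp add: horizontal_def)
    moreover have "lorentz (c *\<^sub>R e) (\<Phi> p - \<Phi> q) = 0"
      if "l \<in> cylinder_rulings u" "p \<in> l" "q \<in> l" for l p q
    proof -
      have "lorentz (c *\<^sub>R e) (\<Phi> p - \<Phi> q) = c * lorentz e (A (p - q))"
        by (simp add: lorentz_def \<Phi> A.diff algebra_simps)
      also have "\<dots> = 0"
        using lorentz_axis_1_orthogonal_ruling[OF that] by (simp add: e_def A(2))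
      finally show ?thesis .
    qed
    then have "orthogonal_to_rulings (c *\<^sub>R e) R"
      by (auto simp: orthogonal_to_rulings_def R)
    ultimately show "g \<in> orthogonal_horizontal_translations R"
      unfolding orthogonal_horizontal_translations_def g by blast
  qed
  moreover have "G \<noteq> {id}"
  proof
    assume "G = {id}"
    obtain T where T: "T \<noteq> 0" "T \<in> P"
      using pendent_profile_periodic[OF u] by (auto simp: P_def)
    have "lorentz e e = lorentz (axis 1 1) (axis 1 1)" unfolding e_def by (rule A(2))
    also have "\<dots> = 1" by (simp add: lorentz_def axis_def)
    finally have "lorentz e e = 1" .
    then have "e \<noteq> 0" by (auto simp: lorentz_def)
    have "(\<lambda>x. x + T *\<^sub>R e) = id" using T \<open>G = {id}\<close> unfolding G_def by blast
    then have "0 + T *\<^sub>R e = 0" by (metis id_apply)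
    with T \<open>e \<noteq> 0\<close> show False by simp
  qed
  moreover have "g ` S = S" if "g \<in> G" for g
  proof -
    from that obtain c where g: "g = (\<lambda>x. x + c *\<^sub>R e)" and "c \<in> P" by (auto simp: G_def)
    then have c: "\<And>r. u (r + c) = u r" by (simp add: P_def)
    have "g (\<Phi> p) = \<Phi> (p + c *\<^sub>R axis 1 1)" for p
      by (simp add: g \<Phi> e_def A.add A.scale)
    then have "g ` S = \<Phi> ` (\<lambda>p. p + c *\<^sub>R axis 1 1) ` cylinder u"
      by (simp add: S image_image)
    also have "\<dots> = S" by (simp add: cylinder_translate[of u c, OF c] S)
    finally show ?thesis .
  qed
  ultimately show ?thesis by blast
qed

end
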